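(* Every pro-symmetric ring is symmetric. That is, let $R$ be a $\ast$-ring (associative, with unity) such that for all $a,b,c\in R$, $abc\in P(R)$ implies $acb\in P(R)$; then $R$ is symmetric.
   Context: A $\ast$-ring is an associative ring with unity equipped with an involution, i.e. a map $a\mapsto a^{\ast}$ with $(a^{\ast})^{\ast}=a$, $(a+b)^{\ast}=a^{\ast}+b^{\ast}$, $(ab)^{\ast}=b^{\ast}a^{\ast}$. $P(R)$ denotes the set of projections of $R$, i.e. elements $p$ with $p^2=p=p^{\ast}$. A $\ast$-ring $R$ is pro-symmetric if, for all $a,b,c\in R$, $abc\in P(R)$ implies $acb\in P(R)$. A ring $R$ is symmetric if, for all $a,b,c\in R$, $abc=0$ implies $acb=0$. *)

theory Defs
  imports "HOL-Algebra.Ring"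
begin

text \<open>The library locale \<open>ring\<close> is an associative ring with unity (not assumed to be commutative,
  and the zero ring is allowed).\<close>

locale star_ring = ring R for R :: "('a, 'm) ring_scheme" (structure) +
  fixes star :: "'a \<Rightarrow> 'a"
  assumes star_closed: "a \<in> carrier R \<Longrightarrow> star a \<in> carrier R"
    and star_star: "a \<in> carrier R \<Longrightarrow> star (star a) = a"
    and star_add: "\<lbrakk>a \<in> carrier R; b \<in> carrier R\<rbrakk> \<Longrightarrow> star (a \<oplus> b) = star a \<oplus> star b"
    and star_mult: "\<lbrakk>a \<in> carrier R; b \<in> carrier R\<rbrakk> \<Longrightarrow> star (a \<otimes> b) = star b \<otimes> star a"

definition projections :: "('a, 'm) ring_scheme \<Rightarrow> ('a \<Rightarrow> 'a) \<Rightarrow> 'a set" where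
  "projections R star = {p \<in> carrier R. p \<otimes>\<^bsub>R\<^esub> p = p \<and> star p = p}"

locale pro_symmetric_ring = star_ring +
  assumes pro_symmetric:
    "\<lbrakk>a \<in> carrier R; b \<in> carrier R; c \<in> carrier R; a \<otimes> b \<otimes> c \<in> projections R star\<rbrakk>
      \<Longrightarrow> a \<otimes> c \<otimes> b \<in> projections R star"

locale symmetric_ring = ring +
  assumes symmetric:
    "\<lbrakk>a \<in> carrier R; b \<in> carrier R; c \<in> carrier R; a \<otimes> b \<otimes> c = \<zero>\<rbrakk> \<Longrightarrow> a \<otimes> c \<otimes> b = \<zero>"

end

theory Submission
  imports Defs
begin

text \<open>Suppose \<open>a b c = 0\<close> and put \<open>e = a c b\<close>. For every \<open>r\<close> the product \<open>(r a) b c\<close> is still zero,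
  hence a projection, so pro-symmetry makes \<open>(r a) c b = r e\<close> a projection: the whole left ideal
  generated by \<open>e\<close> consists of projections. Self-adjointness of all these elements reads
  \<open>r e = e r\<^sup>*\<close>, which lets \<open>e\<close> pass through any factor at the price of a star. Moving factors
  through \<open>e\<close> and back shows that factors to the right of \<open>e\<close> may be permuted, so that
  \<open>e = e e = e a c b = e a b c = 0\<close>.\<close>

lemma (in star_ring) star_zero: "star \<zero> = \<zero>"
proof -
  have "star \<zero> \<oplus> star \<zero> = star \<zero>"
    using star_add[of \<zero> \<zero>, symmetric] by simp
  then show ?thesis
    using add.r_cancel_one[of "star \<zero>" "star \<zero>"] star_closed[of \<zero>] by simp
qed

lemma (in star_ring) zero_in_projections: "\<zero> \<in> projections R star"
  by (simp add: projections_def star_zero)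

text \<open>Taking the star of the self-adjoint element \<open>star r \<otimes> e\<close> gives \<open>star e \<otimes> r\<close>, and \<open>e\<close>, being
  \<open>\<one> \<otimes> e\<close>, is self-adjoint as well.\<close>

lemma (in star_ring) left_ideal_of_projections_twist:
  assumes e: "e \<in> carrier R"
    and proj: "\<And>r. r \<in> carrier R \<Longrightarrow> r \<otimes> e \<in> projections R star"
    and r: "r \<in> carrier R"
  shows "e \<otimes> r = star r \<otimes> e"
proof -
  have "star e = e"
    using proj[of \<one>] e by (simp add: projections_def)
  moreover have "star (star r \<otimes> e) = star r \<otimes> e"
    using proj[of "star r"] r by (simp add: projections_def star_closed)
  ultimately show ?thesis
    using e r by (simp add: star_mult star_closed star_star)
qed

text \<open>Since the star reverses products, carrying \<open>x \<otimes> y\<close> through \<open>e\<close> in one step and bringing the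
  two factors back one at a time exchanges them.\<close>

lemma (in star_ring) left_ideal_of_projections_commute:
  assumes e: "e \<in> carrier R"
    and proj: "\<And>r. r \<in> carrier R \<Longrightarrow> r \<otimes> e \<in> projections R star"
    and xy: "x \<in> carrier R" "y \<in> carrier R"
  shows "e \<otimes> (x \<otimes> y) = e \<otimes> (y \<otimes> x)"
proof -
  note twist = left_ideal_of_projections_twist[OF e proj]
  have "e \<otimes> (x \<otimes> y) = star y \<otimes> (star x \<otimes> e)"
    using e xy twist[of "x \<otimes> y"] by (simp add: star_mult star_closed m_assoc)
  also have "\<dots> = star y \<otimes> (e \<otimes> x)"
    using twist[of x] xy by simp
  also have "\<dots> = (star y \<otimes> e) \<otimes> x"
    using e xy by (simp add: star_closed m_assoc)
  also have "\<dots> = (e \<otimes> y) \<otimes> x"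
    using twist[of y] xy by simp
  also have "\<dots> = e \<otimes> (y \<otimes> x)"
    using e xy by (simp add: m_assoc)
  finally show ?thesis .
qed

lemma (in pro_symmetric_ring) product_zero_swap:
  assumes abc: "a \<in> carrier R" "b \<in> carrier R" "c \<in> carrier R"
    and zero: "a \<otimes> b \<otimes> c = \<zero>"
  shows "a \<otimes> c \<otimes> b = \<zero>"
proof -
  define e where "e = a \<otimes> c \<otimes> b"
  have e: "e \<in> carrier R"
    using abc by (simp add: e_def)
  have proj: "r \<otimes> e \<in> projections R star" if r: "r \<in> carrier R" for r
  proof -
    have "(r \<otimes> a) \<otimes> b \<otimes> c = r \<otimes> (a \<otimes> b \<otimes> c)"
      using abc r by (simp add: m_assoc)
    then have "(r \<otimes> a) \<otimes> b \<otimes> c \<in> projections R star"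
      using r by (simp add: zero zero_in_projections)
    then have "(r \<otimes> a) \<otimes> c \<otimes> b \<in> projections R star"
      using abc r pro_symmetric[of "r \<otimes> a" b c] by simp
    then show ?thesis
      using abc r by (simp add: e_def m_assoc)
  qed
  note twist = left_ideal_of_projections_twist[OF e proj]
  have "e = e \<otimes> e"
    using proj[of \<one>] e by (simp add: projections_def)
  also have "\<dots> = (e \<otimes> a) \<otimes> (c \<otimes> b)"
    using abc e by (simp add: e_def m_assoc)
  \<comment> \<open>Moving \<open>a\<close> to the left puts \<open>e\<close> next to the two factors that are to be exchanged.\<close>
  also have "\<dots> = star a \<otimes> (e \<otimes> (c \<otimes> b))"
    using abc e twist[of a] by (simp add: star_closed m_assoc)
  also have "\<dots> = star a \<otimes> (e \<otimes> (b \<otimes> c))"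
    using left_ideal_of_projections_commute[OF e proj, of c b] abc by simp
  also have "\<dots> = (star a \<otimes> e) \<otimes> (b \<otimes> c)"
    using abc e by (simp add: star_closed m_assoc)
  also have "\<dots> = e \<otimes> (a \<otimes> b \<otimes> c)"
    using abc e twist[of a, symmetric] by (simp add: m_assoc)
  also have "\<dots> = \<zero>"
    using e by (simp add: zero)
  finally show ?thesis
    by (simp add: e_def)
qed

theorem mainTheorem4:
  fixes R :: "('a, 'm) ring_scheme" and star :: "'a \<Rightarrow> 'a"
  assumes "pro_symmetric_ring R star"
  shows "symmetric_ring R"
proof -
  interpret pro_symmetric_ring R star
    by (fact assms)
  show ?thesis
    by unfold_locales (rule product_zero_swap)
qed

end
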